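(* For every $C > 0$ there exists a sequence of random variables $\{X_n\}_{n \ge 1}$, with $X_n$ taking values in $\{0,\ldots,n\}$, having standard deviation $\sigma_n$ and probability generating function $P_n$, such that $\sigma_n > C \log n$ for all sufficiently large $n$, every complex root $\zeta$ of each of the polynomials $P_n$ satisfies $|1-\zeta| > 1$, and $\{X_n\}$ does not satisfy a central limit theorem.
   Context: The probability generating function of a random variable $X_n \in \{0,\ldots,n\}$ is the polynomial $P_n(z) = \sum_{k=0}^n \mathbb{P}(X_n = k) z^k$. A sequence $\{X_n\}$ with means $\mu_n$ and standard deviations $\sigma_n$ (positive for all large $n$) satisfies a central limit theorem if $X_n^* = (X_n - \mu_n)\sigma_n^{-1}$ converges in distribution to $Z \sim \mathcal{N}(0,1)$ as $n \to \infty$. *)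

theory Defs
  imports "HOL-Probability.Probability" "HOL-Computational_Algebra.Polynomial"
begin

definition std_dev :: "'a measure \<Rightarrow> ('a \<Rightarrow> nat) \<Rightarrow> real" where
  "std_dev M X = sqrt (prob_space.variance M (\<lambda>\<omega>. real (X \<omega>)))"

text \<open>The parameter \<open>n\<close> is the bound on the values of \<open>X\<close>; the coefficients are
  embedded into the complex numbers so that roots are complex roots.\<close>

definition prob_gen_poly :: "'a measure \<Rightarrow> nat \<Rightarrow> ('a \<Rightarrow> nat) \<Rightarrow> complex poly" where
  "prob_gen_poly M n X =
     (\<Sum>k\<le>n. monom (complex_of_real (measure M {\<omega> \<in> space M. X \<omega> = k})) k)"

definition standardize :: "'a measure \<Rightarrow> ('a \<Rightarrow> nat) \<Rightarrow> 'a \<Rightarrow> real" where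
  "standardize M X \<omega> =
     (real (X \<omega>) - prob_space.expectation M (\<lambda>\<omega>'. real (X \<omega>'))) / std_dev M X"

text \<open>This is meant for sequences whose standard deviations are eventually positive; at
  the finitely many other indices the standardization is \<open>0\<close> by division by zero, which
  does not affect the limit.\<close>

definition satisfies_CLT :: "'a measure \<Rightarrow> (nat \<Rightarrow> 'a \<Rightarrow> nat) \<Rightarrow> bool" where
  "satisfies_CLT M X \<longleftrightarrow>
     weak_conv_m (\<lambda>n. distr M borel (standardize M (X n))) std_normal_distribution"

end

theory Submission
  imports Defs "HOL-Real_Asymp.Real_Asymp"
begin

text \<open>
  The example is a Poisson-like law stretched over a lattice of mesh about \<open>log n\<close>. Put
  \<open>L = \<lfloor>log n\<rfloor>\<close>, \<open>m = \<lfloor>n / L\<rfloor>\<close>, fix a constant \<open>a\<close>, and let \<open>X\<^sub>n = L \<cdot> Y\<^sub>n\<close> with \<open>Y\<^sub>n\<close>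
  binomial with parameters \<open>m\<close> and \<open>p = a / m\<close>. Three things then hold for large \<open>n\<close>.

  The standard deviation is \<open>L * sqrt (a * (1 - p))\<close>, about \<open>sqrt a * log n\<close>, so a large \<open>a\<close>
  beats any prescribed \<open>C\<close>; the choice \<open>a = 16 C\<^sup>2\<close> leaves room for \<open>p < 1/2\<close> and for the
  rounding in \<open>L\<close>.

  The probability generating function is \<open>(p z\<^sup>L + 1 - p)\<^sup>m\<close>
  (\<open>pgf_scaled_binomial_pmf\<close>). All its roots have modulus \<open>((m - a) / a) powr (1 / L)\<close>. As
  \<open>2\<^sup>L\<close> is at most \<open>n powr ln 2\<close> and \<open>ln 2 < 1\<close>, while \<open>m\<close> is of order \<open>n / log n\<close>, this
  modulus exceeds \<open>2\<close> (\<open>eventually_block_count_large\<close>), and a root outside the disc of radius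
  \<open>2\<close> about \<open>0\<close> lies outside the disc of radius \<open>1\<close> about \<open>1\<close>.

  The mean \<open>L * a\<close> is at most a constant multiple of the standard deviation. Since \<open>X\<^sub>n\<close> is
  nonnegative, its standardization is bounded below uniformly in \<open>n\<close>, which a sequence
  converging to the standard normal law cannot be (\<open>not_satisfies_CLT_if_mean_le\<close>). This avoids
  identifying the true limit, a standardized Poisson law.

  At the finitely many small indices where the estimates fail, \<open>X\<^sub>n = 0\<close>, whose generating
  function \<open>1\<close> has no roots.
\<close>

section \<open>Realising a sequence of laws on one space\<close>

text \<open>
  The variables are the coordinates of a product space. A coordinate may leave \<open>{..n}\<close> on a
  null set, so it is cut off at \<open>n\<close> to make the bound hold at every point.
\<close>

lemma exists_variables_with_laws:
  fixes D :: "nat \<Rightarrow> nat pmf"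
  assumes supp: "\<And>n. set_pmf (D n) \<subseteq> {..n}"
  obtains M :: "(nat \<Rightarrow> nat) measure" and X :: "nat \<Rightarrow> (nat \<Rightarrow> nat) \<Rightarrow> nat"
  where "prob_space M" "\<And>n. X n \<in> M \<rightarrow>\<^sub>M count_space UNIV" "\<And>n \<omega>. X n \<omega> \<le> n"
    "\<And>n. distr M (count_space UNIV) (X n) = measure_pmf (D n)"
proof -
  define M where "M = Pi\<^sub>M UNIV (\<lambda>n. measure_pmf (D n))"
  define X where "X = (\<lambda>(n::nat) (\<omega>::nat \<Rightarrow> nat). min n (\<omega> n))"
  interpret product_prob_space "\<lambda>n. measure_pmf (D n)" UNIV
    by unfold_locales
  have coord: "(\<lambda>\<omega>. \<omega> n) \<in> M \<rightarrow>\<^sub>M measure_pmf (D n)" for n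
    unfolding M_def by measurable
  have law: "distr M (measure_pmf (D n)) (\<lambda>\<omega>. \<omega> n) = measure_pmf (D n)" for n
    unfolding M_def by (rule distr_PiM_component) (auto intro: prob_space_measure_pmf)
  have meas: "X n \<in> M \<rightarrow>\<^sub>M count_space UNIV" for n
    unfolding X_def using measurable_compose[OF coord[of n], of "min n" "count_space UNIV"] by simp
  have "distr M (count_space UNIV) (X n) = measure_pmf (D n)" for n
  proof -
    have "distr M (count_space UNIV) (X n)
        = distr (distr M (measure_pmf (D n)) (\<lambda>\<omega>. \<omega> n)) (count_space UNIV) (min n)"
      unfolding X_def by (subst distr_distr[OF _ coord]) (auto simp: comp_def)
    also have "\<dots> = measure_pmf (map_pmf (min n) (D n))"
      by (simp add: law map_pmf_rep_eq)
    also have "map_pmf (min n) (D n) = D n"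
      using supp[of n] by (intro map_pmf_idI) (auto simp: min_def dest!: subsetD)
    finally show ?thesis .
  qed
  moreover have "prob_space M"
    unfolding M_def by (rule P.prob_space_axioms)
  moreover have "X n \<omega> \<le> n" for n \<omega>
    by (simp add: X_def)
  ultimately show thesis
    using that meas by blast
qed

lemma expectation_via_law:
  fixes f :: "nat \<Rightarrow> 'b :: {banach, second_countable_topology}"
  assumes "X \<in> M \<rightarrow>\<^sub>M count_space UNIV" "distr M (count_space UNIV) X = measure_pmf D"
  shows "integral\<^sup>L M (\<lambda>\<omega>. f (X \<omega>)) = measure_pmf.expectation D f"
  using assms(1) by (simp add: integral_distr assms(2)[symmetric])

lemma std_dev_via_law:
  assumes "X \<in> M \<rightarrow>\<^sub>M count_space UNIV" "distr M (count_space UNIV) X = measure_pmf D"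
  shows "std_dev M X = sqrt (measure_pmf.variance D real)"
  using expectation_via_law[OF assms, of real]
    expectation_via_law[OF assms, of "\<lambda>k. (real k - measure_pmf.expectation D real)\<^sup>2"]
  by (simp add: std_dev_def)

lemma poly_prob_gen_poly_via_law:
  assumes "X \<in> M \<rightarrow>\<^sub>M count_space UNIV" "distr M (count_space UNIV) X = measure_pmf D"
    and supp: "set_pmf D \<subseteq> {..n}"
  shows "poly (prob_gen_poly M n X) z = measure_pmf.expectation D (\<lambda>k. z ^ k)"
proof -
  have "measure M {\<omega> \<in> space M. X \<omega> = k} = pmf D k" for k
  proof -
    have "measure (distr M (count_space UNIV) X) {k} = measure M (X -` {k} \<inter> space M)"
      by (rule measure_distr) (use assms(1) in auto)
    moreover have "X -` {k} \<inter> space M = {\<omega> \<in> space M. X \<omega> = k}"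
      by auto
    ultimately show ?thesis
      by (simp add: assms(2) measure_pmf_single)
  qed
  moreover have "measure_pmf.expectation D (\<lambda>k. z ^ k) = (\<Sum>k\<le>n. pmf D k *\<^sub>R z ^ k)"
    using supp by (intro integral_measure_pmf) auto
  ultimately show ?thesis
    by (simp add: prob_gen_poly_def poly_sum poly_monom scaleR_conv_of_real)
qed

section \<open>Scaled binomial laws\<close>

text \<open>
  The binomial weights are the Bernstein polynomials, whose first two factorial moments are
  known from the proof of the Weierstrass approximation theorem; they give mean and variance.
\<close>

lemma expectation_binomial_pmf:
  assumes "p \<in> {0..1}"
  shows "measure_pmf.expectation (binomial_pmf m p) real = m * p"
proof -
  have "measure_pmf.expectation (binomial_pmf m p) real = (\<Sum>k\<le>m. real k * Bernstein m k p)"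
    using assms by (simp add: expectation_binomial_pmf' Bernstein_def mult_ac)
  then show ?thesis
    by (simp add: sum_k_Bernstein)
qed

lemma expectation_scaled_binomial_pmf:
  assumes "p \<in> {0..1}"
  shows "measure_pmf.expectation (map_pmf ((*) L) (binomial_pmf m p)) real = L * (m * p)"
  by (simp add: expectation_binomial_pmf[OF assms])

lemma variance_scaled_binomial_pmf:
  assumes "p \<in> {0..1}"
  shows "measure_pmf.variance (map_pmf ((*) L) (binomial_pmf m p)) real
    = (real L)\<^sup>2 * (m * p * (1 - p))"
proof -
  have "measure_pmf.variance (map_pmf ((*) L) (binomial_pmf m p)) real
      = measure_pmf.expectation (binomial_pmf m p) (\<lambda>k. (real L)\<^sup>2 * (real k - m * p)\<^sup>2)"
    by (simp add: expectation_binomial_pmf[OF assms] power_mult_distrib[symmetric]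
        right_diff_distrib)
  also have "\<dots> = (real L)\<^sup>2 * (\<Sum>k\<le>m. (real k - m * p)\<^sup>2 * Bernstein m k p)"
    using assms by (simp add: expectation_binomial_pmf' Bernstein_def mult_ac)
  also have "(\<Sum>k\<le>m. (real k - m * p)\<^sup>2 * Bernstein m k p)
      = (\<Sum>k\<le>m. real k * (real k - 1) * Bernstein m k p)
        + (1 - 2 * (m * p)) * (\<Sum>k\<le>m. real k * Bernstein m k p)
        + (m * p)\<^sup>2 * (\<Sum>k\<le>m. Bernstein m k p)"
    unfolding sum_distrib_left sum.distrib[symmetric]
    by (rule sum.cong) (auto simp: power2_eq_square algebra_simps)
  also have "\<dots> = m * p * (1 - p)"
    unfolding sum_k_Bernstein sum_kk_Bernstein sum_Bernstein
    by (simp add: power2_eq_square algebra_simps)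
  finally show ?thesis .
qed

lemma pgf_scaled_binomial_pmf:
  fixes z :: complex
  assumes "p \<in> {0..1}"
  shows "measure_pmf.expectation (map_pmf ((*) L) (binomial_pmf m p)) (\<lambda>k. z ^ k)
    = (of_real p * z ^ L + of_real (1 - p)) ^ m"
  using assms
  by (simp add: expectation_binomial_pmf' binomial_ring scaleR_conv_of_real power_mult[symmetric]
      power_mult_distrib mult_ac)

text \<open>
  At a root, \<open>\<bar>z\<bar> ^ L = (1 - p) / p > 2 ^ L\<close>, hence \<open>\<bar>z\<bar> > 2\<close>.
\<close>

lemma root_scaled_binomial_far_from_one:
  fixes z :: complex
  assumes p: "0 < p" and large: "2 ^ L * p < 1 - p"
    and root: "(of_real p * z ^ L + of_real (1 - p)) ^ m = 0"
  shows "cmod (1 - z) > 1"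
proof -
  have "of_real p * z ^ L = - of_real (1 - p)"
    using root by (simp only: power_eq_0_iff eq_neg_iff_add_eq_0)
  then have "cmod (of_real p * z ^ L) = cmod (of_real (1 - p))"
    by (simp only: norm_minus_cancel)
  then have "p * cmod z ^ L = \<bar>1 - p\<bar>"
    using p by (simp only: norm_mult norm_of_real norm_power)
  then have "2 ^ L * p < cmod z ^ L * p"
    using large by (simp add: mult.commute)
  then have "2 ^ L < cmod z ^ L"
    using p by simp
  then have "2 < cmod z"
    using power_less_imp_less_base by (metis norm_ge_zero)
  then show ?thesis
    using norm_triangle_ineq2[of z 1] by (simp add: norm_minus_commute)
qed

section \<open>An obstruction to the central limit theorem\<close>

lemma cdf_std_normal_distribution_pos: "cdf std_normal_distribution x > 0"
proof (rule ccontr)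
  assume nonpos: "\<not> ?thesis"
  interpret real_distribution std_normal_distribution
    by (rule real_dist_normal_dist)
  from nonpos have "measure std_normal_distribution {..x} = 0"
    using measure_nonneg[of std_normal_distribution "{..x}"] by (simp add: cdf_def)
  then have "emeasure std_normal_distribution {..x} = 0"
    by (simp add: emeasure_eq_measure)
  then have "{..x} \<in> null_sets std_normal_distribution"
    by (simp add: null_sets_def)
  then have "AE y in lborel. y \<in> {..x} \<longrightarrow> ennreal (std_normal_density y) = 0"
    by (subst (asm) null_sets_density_iff) auto
  then have "AE y in lborel. y \<notin> {..x}"
  proof eventually_elim
    case (elim y)
    have "std_normal_density y > 0"
      by (rule normal_density_pos) simp
    with elim show ?case
      by (auto simp: ennreal_eq_0_iff)
  qed
  then have "emeasure lborel {..x} = 0"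
    by (subst (asm) AE_iff_measurable[of "{..x}"]) auto
  moreover have "emeasure lborel {x - 1..x} \<le> emeasure lborel {..x}"
    by (rule emeasure_mono) auto
  ultimately show False
    by simp
qed

lemma isCont_cdf_std_normal_distribution: "isCont (cdf std_normal_distribution) x"
proof -
  interpret real_distribution std_normal_distribution
    by (rule real_dist_normal_dist)
  have "emeasure std_normal_distribution {x} = 0"
    by (subst emeasure_density) (auto intro!: nn_integral_null_set)
  then show ?thesis
    by (simp add: isCont_cdf measure_def)
qed

text \<open>
  A nonnegative variable standardizes to at least \<open>- mean / std_dev\<close>. If this is at least
  \<open>- c\<close>, the distribution functions all vanish at \<open>- c - 1\<close>, where the normal one is positive.
\<close>

lemma not_satisfies_CLT_if_mean_le:
  assumes M: "prob_space M"
    and X: "\<And>n. X n \<in> M \<rightarrow>\<^sub>M count_space UNIV"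
    and c: "c \<ge> 0"
    and mean: "\<forall>\<^sub>F n in sequentially.
      prob_space.expectation M (\<lambda>\<omega>. real (X n \<omega>)) \<le> c * std_dev M (X n)"
  shows "\<not> satisfies_CLT M X"
proof
  assume "satisfies_CLT M X"
  then have "(\<lambda>n. cdf (distr M borel (standardize M (X n))) (- c - 1))
      \<longlonglongrightarrow> cdf std_normal_distribution (- c - 1)"
    by (simp add: satisfies_CLT_def weak_conv_m_def weak_conv_def
        isCont_cdf_std_normal_distribution)
  moreover have "\<forall>\<^sub>F n in sequentially. cdf (distr M borel (standardize M (X n))) (- c - 1) = 0"
    using mean
  proof eventually_elim
    case (elim n)
    let ?\<mu> = "prob_space.expectation M (\<lambda>\<omega>. real (X n \<omega>))" and ?\<sigma> = "std_dev M (X n)"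
    have "standardize M (X n) \<omega> \<ge> - c" for \<omega>
    proof (cases "?\<sigma> = 0")
      case False
      then have pos: "?\<sigma> > 0"
        by (simp add: std_dev_def less_le)
      have "- c * ?\<sigma> \<le> real (X n \<omega>) - ?\<mu>"
        using elim by simp
      then show ?thesis
        using pos by (simp add: standardize_def pos_le_divide_eq)
    qed (use c in \<open>simp add: standardize_def\<close>)
    then have "\<not> standardize M (X n) \<omega> \<le> - c - 1" for \<omega>
      by (smt (verit))
    then have "standardize M (X n) -` {..- c - 1} \<inter> space M = {}"
      by auto
    moreover have "standardize M (X n) \<in> borel_measurable M"
      unfolding standardize_def using X[of n] by measurable
    ultimately show ?case
      by (simp add: cdf_def measure_distr)
  qed
  ultimately have "(\<lambda>n. 0) \<longlonglongrightarrow> cdf std_normal_distribution (- c - 1)"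
    by (rule Lim_transform_eventually)
  then show False
    using cdf_std_normal_distribution_pos[of "- c - 1"] by (simp add: LIMSEQ_const_iff)
qed

section \<open>The sequence\<close>

text \<open>
  The inequality says \<open>2 ^ L < (m - a) / a\<close> for \<open>L = \<lfloor>ln n\<rfloor>\<close> and \<open>m = n div L\<close>, which is what
  places the roots. It is where the logarithmic size of \<open>L\<close> is essential: \<open>2 ^ L\<close> must stay
  below a power of \<open>n\<close> with exponent less than \<open>1\<close>. The bound \<open>ln 2 \<le> 25/36\<close> makes that exponent
  explicit.
\<close>

lemma eventually_block_count_large:
  fixes a :: real
  assumes "a > 0"
  shows "\<forall>\<^sub>F n in sequentially. (2 ^ nat \<lfloor>ln (real n)\<rfloor> + 1) * a < real (n div nat \<lfloor>ln (real n)\<rfloor>)"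
proof -
  have "\<forall>\<^sub>F n in sequentially. (real n powr (25 / 36) + 1) * a < real n / ln (real n) - 1"
    using assms by real_asymp
  moreover have "\<forall>\<^sub>F n in sequentially. ln (real n) > 1"
    by real_asymp
  ultimately show ?thesis
  proof eventually_elim
    case (elim n)
    let ?L = "nat \<lfloor>ln (real n)\<rfloor>"
    have L: "1 \<le> ?L" "real ?L \<le> ln (real n)"
      using elim by linarith+
    have n: "real n \<ge> 1"
      using elim by (cases n) auto
    have "2 ^ ?L = (2::real) powr real ?L"
      by (simp add: powr_realpow)
    also have "\<dots> \<le> 2 powr ln (real n)"
      using L by (intro powr_mono) auto
    also have "\<dots> = real n powr ln 2"
      using n by (simp add: powr_def mult.commute)
    also have "\<dots> \<le> real n powr (25 / 36)"
      using n ln2_le_25_over_36 by (intro powr_mono) auto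
    finally have "(2 ^ ?L + 1) * a \<le> (real n powr (25 / 36) + 1) * a"
      using assms by simp
    also have "\<dots> < real n / ln (real n) - 1"
      using elim by simp
    also have "\<dots> \<le> real n / real ?L - 1"
      using L by (intro diff_right_mono divide_left_mono) auto
    also have "\<dots> \<le> real (n div ?L)"
      using real_of_int_floor_add_one_gt[of "real n / real ?L"]
      by (simp add: floor_divide_of_nat_eq)
    finally show ?case .
  qed
qed

theorem theorem17:
  fixes C :: real
  assumes "C > 0"
  shows "\<exists>(M :: (nat \<Rightarrow> nat) measure) (X :: nat \<Rightarrow> (nat \<Rightarrow> nat) \<Rightarrow> nat).
    prob_space M \<and>
    (\<forall>n\<ge>1. X n \<in> M \<rightarrow>\<^sub>M count_space UNIV \<and> (\<forall>\<omega>\<in>space M. X n \<omega> \<in> {0..n})) \<and>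
    (\<forall>\<^sub>F n in sequentially. std_dev M (X n) > C * ln (real n)) \<and>
    (\<forall>n\<ge>1. \<forall>\<zeta>::complex. poly (prob_gen_poly M n (X n)) \<zeta> = 0 \<longrightarrow> cmod (1 - \<zeta>) > 1) \<and>
    \<not> satisfies_CLT M X"
proof -
  define a where "a = 16 * C\<^sup>2"
  define L where "L n = nat \<lfloor>ln (real n)\<rfloor>" for n
  define m where "m n = n div L n" for n
  define p where "p n = a / m n" for n
  \<comment> \<open>If \<open>L n = 0\<close> then \<open>m n = 0\<close>, so \<open>good n\<close> implies that both are positive.\<close>
  define good where "good n \<longleftrightarrow> (2 ^ L n + 1) * a < m n" for n
  define D where "D n = (if good n then map_pmf ((*) (L n)) (binomial_pmf (m n) (p n))
    else return_pmf 0)" for n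
  have a: "a > 0"
    using assms by (simp add: a_def)
  have ev_good: "\<forall>\<^sub>F n in sequentially. good n"
    unfolding good_def m_def L_def using a by (rule eventually_block_count_large)
  have p: "0 < p n" "p n < 1 / 2" "m n * p n = a" "2 ^ L n * p n < 1 - p n" if "good n" for n
  proof -
    have "a \<le> 2 ^ L n * a"
      using a by simp
    then have "2 * a < m n"
      using that by (simp add: good_def distrib_right)
    then show "0 < p n" "p n < 1 / 2" "m n * p n = a" "2 ^ L n * p n < 1 - p n"
      using that a by (auto simp: p_def good_def field_simps)
  qed
  have "set_pmf (D n) \<subseteq> {..n}" for n
  proof -
    have "L n * k \<le> n" if "k \<le> m n" for k
      using mult_le_mono2[OF that, of "L n"] times_div_less_eq_dividend[of "L n" n]
      unfolding m_def by (rule order_trans)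
    then show ?thesis
      using p[of n] by (auto simp: D_def)
  qed
  note supp = this
  obtain M :: "(nat \<Rightarrow> nat) measure" and X :: "nat \<Rightarrow> (nat \<Rightarrow> nat) \<Rightarrow> nat" where
    M: "prob_space M" and X: "\<And>n. X n \<in> M \<rightarrow>\<^sub>M count_space UNIV" "\<And>n \<omega>. X n \<omega> \<le> n"
    and law: "\<And>n. distr M (count_space UNIV) (X n) = measure_pmf (D n)"
    using exists_variables_with_laws[OF supp] by blast

  have std: "std_dev M (X n) \<ge> 2 * C * L n" if "good n" for n
  proof -
    have "(2 * C * L n)\<^sup>2 \<le> (real (L n))\<^sup>2 * (a * (1 / 2))"
      by (simp add: a_def power_mult_distrib)
    also have "\<dots> \<le> (real (L n))\<^sup>2 * (a * (1 - p n))"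
      using p[OF that] a by (intro mult_left_mono) auto
    also have "\<dots> = (std_dev M (X n))\<^sup>2"
      using p[OF that] a
      by (simp add: std_dev_via_law[OF X(1) law] D_def that variance_scaled_binomial_pmf
          del: integral_map_pmf)
    finally show ?thesis
      by (rule power2_le_imp_le) (simp add: std_dev_def)
  qed
  have mean: "prob_space.expectation M (\<lambda>\<omega>. real (X n \<omega>)) = L n * a" if "good n" for n
    using p[OF that]
    by (simp add: expectation_via_law[OF X(1) law] D_def that expectation_scaled_binomial_pmf
        del: integral_map_pmf)

  have "\<forall>\<^sub>F n in sequentially. std_dev M (X n) > C * ln (real n)"
  proof -
    have "\<forall>\<^sub>F n in sequentially. ln (real n) > 2"
      by real_asymp
    with ev_good show ?thesis
    proof eventually_elim
      case (elim n)
      then have "ln (real n) < 2 * L n"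
        unfolding L_def by linarith
      then have "C * ln (real n) < C * (2 * L n)"
        using assms by simp
      then show ?case
        using std[OF \<open>good n\<close>] by simp
    qed
  qed
  moreover have "cmod (1 - \<zeta>) > 1" if "poly (prob_gen_poly M n (X n)) \<zeta> = 0" for n \<zeta>
  proof -
    have root: "measure_pmf.expectation (D n) (\<lambda>k. \<zeta> ^ k) = 0"
      using that poly_prob_gen_poly_via_law[OF X(1) law supp, of n \<zeta>] by simp
    show ?thesis
    proof (cases "good n")
      case True
      with root p[OF True] show ?thesis
        by (intro root_scaled_binomial_far_from_one[of "p n" "L n" \<zeta> "m n"])
          (auto simp: D_def pgf_scaled_binomial_pmf simp del: integral_map_pmf)
    next
      case False
      with root show ?thesis
        by (simp add: D_def)
    qed
  qed
  moreover have "\<not> satisfies_CLT M X"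
  proof (rule not_satisfies_CLT_if_mean_le[OF M X(1), of "8 * C"])
    show "\<forall>\<^sub>F n in sequentially.
        prob_space.expectation M (\<lambda>\<omega>. real (X n \<omega>)) \<le> 8 * C * std_dev M (X n)"
      using ev_good
    proof eventually_elim
      case (elim n)
      \<comment> \<open>\<open>a = 16 * C\<^sup>2\<close>, and the standard deviation is at least \<open>2 * C * L n\<close>.\<close>
    have "L n * a = 8 * C * (2 * C * L n)"
        by (simp add: a_def power2_eq_square)
      also have "\<dots> \<le> 8 * C * std_dev M (X n)"
        using std[OF elim] assms by (intro mult_left_mono) auto
      finally show ?case
        by (simp add: mean[OF elim])
    qed
  qed (use assms in simp)
  ultimately show ?thesis
    using M X by (intro exI[of _ M] exI[of _ X]) auto
qed

end
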